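(* Let $1<\zeta\le 2$ and let $h:[0,1]\times\mathbb{R}\to[0,\infty)$ be a continuous function such that: (i) $h$ is non-decreasing in its second variable; (ii) there is $\alpha\in(0,1)$ such that for each $\mu\in[0,1]$ and all $u,v\in C[0,1]$ with $u(t)\le v(t)$ for all $t\in[0,1]$, $$|h(\mu,u(\mu))-h(\mu,v(\mu))|\le\frac{\alpha\,\Gamma(\alpha+1)}{4}\,|u(\mu)-v(\mu)|.$$ Then the fractional differential equation $$D^{\zeta}(f(t))=h(t,f(t)),\qquad t\in[0,1],$$ subject to the integral boundary conditions $f(0)=0$ and $I f(1)=f'(0)$, admits a solution in $C[0,1]$.
   Context: $C[0,1]$ is the set of continuous real-valued functions on $[0,1]$. $D^\zeta$ is the Caputo fractional derivative of order $\zeta$, $$D^\zeta(f(t))=\frac{1}{\Gamma(i-\zeta)}\int_0^t(t-s)^{i-\zeta-1}f^{(i)}(s)\,ds,\qquad i-1<\zeta<i,\ i=[\zeta]+1,$$ (so $i=2$ for $1<\zeta<2$), with the usual convention $D^2f=f''$ for $\zeta=2$. The Riemann–Liouville fractional integral of order $\zeta$ is $I^\zeta f(t)=\frac{1}{\Gamma(\zeta)}\int_0^t(t-s)^{\zeta-1}f(s)\,ds$, and $I=I^1$, so $If(1)=\int_0^1 f(s)\,ds$.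
   Formalization: For 1<ζ<2 the displayed Caputo formula needs f'' and always gives 0 at t=0, so the claim fails literally (e.g. h=1); instead D^ζ f is taken as the second derivative of I^{2-ζ}(f - f(0) - f'(0)t), one-sided at 0 and 1, which extends the displayed formula. *)

theory Defs
  imports "HOL-Analysis.Analysis"
begin

text \<open>
  Riemann--Liouville integral of order \<open>\<zeta> \<ge> 0\<close>, based at \<open>0\<close>. The case \<open>\<zeta> = 0\<close> is the usual
  convention \<open>I\<^sup>0 = id\<close> and makes \<open>\<zeta> = 2\<close> uniform with \<open>1 < \<zeta> < 2\<close> below.
\<close>

definition rl_integral :: "real \<Rightarrow> (real \<Rightarrow> real) \<Rightarrow> real \<Rightarrow> real" where
  "rl_integral \<zeta> f t =
     (if \<zeta> = 0 then f t
      else 1 / Gamma \<zeta> * integral {0..t} (\<lambda>s. (t - s) powr (\<zeta> - 1) * f s))"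

text \<open>
  Caputo derivative on \<open>[0,1]\<close> of order \<open>\<zeta> \<in> (1,2]\<close>, as a relation: \<open>f\<close> has Caputo derivative
  \<open>g\<close> on \<open>[0,1]\<close>.

  The formula \<open>I\<^bsup>2-\<zeta>\<^esup> f''\<close> presupposes a second derivative of \<open>f\<close>, which a solution of
  \<open>D\<^sup>\<zeta> f = g\<close> with \<open>g\<close> merely continuous need not possess, and at \<open>t = 0\<close> it always gives the
  value \<open>0\<close> if \<open>\<zeta> < 2\<close>. The standard extension to such \<open>f\<close> takes the two derivatives outside the
  integral, after removal of the Taylor polynomial of \<open>f\<close> at \<open>0\<close>:
  \<open>D\<^sup>\<zeta> f = (d/dt)\<^sup>2 I\<^bsup>2-\<zeta>\<^esup> (f - f(0) - f'(0) t)\<close>, with derivatives at \<open>0\<close> and \<open>1\<close> one-sided.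
  For \<open>\<zeta> = 2\<close> this is \<open>f''\<close>. The lemma \<open>has_caputo_derivative_classical\<close> below shows that it
  extends the formula \<open>I\<^bsup>2-\<zeta>\<^esup> f''\<close>, and \<open>has_caputo_derivative_unique\<close> that it determines \<open>g\<close>.
\<close>

definition has_caputo_derivative :: "real \<Rightarrow> (real \<Rightarrow> real) \<Rightarrow> (real \<Rightarrow> real) \<Rightarrow> bool" where
  "has_caputo_derivative \<zeta> f g \<longleftrightarrow>
     (\<exists>d J'. (f has_real_derivative d) (at 0 within {0..1}) \<and>
        (\<forall>t\<in>{0..1}.
           (rl_integral (2 - \<zeta>) (\<lambda>s. f s - f 0 - d * s) has_real_derivative J' t)
             (at t within {0..1}) \<and>
           (J' has_real_derivative g t) (at t within {0..1})))"

lemma has_real_derivative_unique_01: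
  fixes f :: "real \<Rightarrow> real"
  assumes "t \<in> {0..1}"
    and "(f has_real_derivative a) (at t within {0..1})"
    and "(f has_real_derivative b) (at t within {0..1})"
  shows "a = b"
proof -
  have "at t within {0..1} \<noteq> (bot :: real filter)"
    using assms(1) by (simp add: trivial_limit_within islimpt_Icc)
  then show ?thesis
    using assms(2,3) unfolding has_field_derivative_iff by (metis tendsto_unique)
qed

lemma has_caputo_derivative_unique:
  assumes "has_caputo_derivative \<zeta> f g" "has_caputo_derivative \<zeta> f g'" "t \<in> {0..1}"
  shows "g t = g' t"
proof -
  let ?J = "\<lambda>d. rl_integral (2 - \<zeta>) (\<lambda>s. f s - f 0 - d * s)"
  obtain d A where A: "(f has_real_derivative d) (at 0 within {0..1})"
    "\<And>t. t \<in> {0..1} \<Longrightarrow> (?J d has_real_derivative A t) (at t within {0..1})"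
    "\<And>t. t \<in> {0..1} \<Longrightarrow> (A has_real_derivative g t) (at t within {0..1})"
    using assms(1) unfolding has_caputo_derivative_def by blast
  obtain e B where B: "(f has_real_derivative e) (at 0 within {0..1})"
    "\<And>t. t \<in> {0..1} \<Longrightarrow> (?J e has_real_derivative B t) (at t within {0..1})"
    "\<And>t. t \<in> {0..1} \<Longrightarrow> (B has_real_derivative g' t) (at t within {0..1})"
    using assms(2) unfolding has_caputo_derivative_def by blast
  have "d = e"
    using has_real_derivative_unique_01[OF _ A(1) B(1)] by simp
  then have eq: "A s = B s" if "s \<in> {0..1}" for s
    using has_real_derivative_unique_01[OF that A(2)[OF that]] B(2)[OF that] by simp
  have "(A has_real_derivative g' t) (at t within {0..1})"
    by (rule has_field_derivative_transform_within[OF B(3)[OF assms(3)] zero_less_one assms(3)])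
       (simp add: eq)
  then show ?thesis
    using has_real_derivative_unique_01[OF assms(3) A(3)] assms(3) by blast
qed

lemma triangle_swap:
  fixes \<phi> :: "real \<Rightarrow> real" and K :: "real \<Rightarrow> real \<Rightarrow> real"
  assumes t: "0 \<le> t" and b: "0 < b"
    and \<phi>: "integrable lborel \<phi>"
    and K: "case_prod K \<in> borel_measurable (borel \<Otimes>\<^sub>M borel)"
    and pos: "\<And>r s. 0 \<le> K r s"
    and int: "\<And>r. 0 < r \<Longrightarrow> r < t \<Longrightarrow> (K r has_integral (t - r) powr b / b) {r..t}"
  shows "((\<lambda>s. integral {0..s} (\<lambda>r. K r s * \<phi> r)) has_integral
          integral\<^sup>L lborel (\<lambda>r. indicator {0<..<t} r * ((t - r) powr b / b * \<phi> r))) {0..t}"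
proof -
  define F where "F = (\<lambda>r s. indicator {0<..<t} r * indicator {r..t} s * (K r s * \<phi> r))"
  have \<phi>m [measurable]: "\<phi> \<in> borel_measurable borel"
    using borel_measurable_integrable[OF \<phi>] by simp
  note K[measurable]
  have Fm: "case_prod F \<in> borel_measurable (lborel \<Otimes>\<^sub>M lborel)"
  proof -
    have eq: "case_prod F = (\<lambda>x. (if 0 < fst x \<and> fst x < t \<and> fst x \<le> snd x \<and> snd x \<le> t
               then case_prod K x * \<phi> (fst x) else 0))"
      by (auto simp: F_def fun_eq_iff indicator_def)
    have "case_prod F \<in> borel_measurable (borel \<Otimes>\<^sub>M borel)"
      unfolding eq by measurable
    then show ?thesis
      by (simp cong: measurable_cong_sets sets_pair_measure_cong)
  qed
  have Kint: "integrable lborel (\<lambda>s. indicator {r..t} s * K r s) \<and>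
      integral\<^sup>L lborel (\<lambda>s. indicator {r..t} s * K r s) = (t - r) powr b / b"
    if r: "0 < r" "r < t" for r
  proof -
    have "K r \<in> borel_measurable borel"
      using measurable_compose[OF measurable_Pair1' K, of r] by simp
    then have m: "set_borel_measurable borel {r..t} (K r)"
      by (auto simp: set_borel_measurable_def)
    have "K r absolutely_integrable_on {r..t}"
      using int[OF r] pos by (intro nonnegative_absolutely_integrable_1) auto
    then have si: "set_integrable lborel {r..t} (K r)"
      using m unfolding set_integrable_def set_borel_measurable_def
      by (subst (asm) integrable_completion) auto
    show ?thesis
      using si set_borel_integral_eq_integral(2)[OF si] int[OF r]
      by (simp add: set_integrable_def set_lebesgue_integral_def integral_unique)
  qed
  have inner: "integral\<^sup>L lborel (F r) = indicator {0<..<t} r * ((t - r) powr b / b * \<phi> r)"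
    and innern: "integral\<^sup>L lborel (\<lambda>s. norm (F r s))
                 = indicator {0<..<t} r * ((t - r) powr b / b * \<bar>\<phi> r\<bar>)"
    and innerI: "integrable lborel (F r)" for r
  proof -
    have e1: "F r = (\<lambda>s. (indicator {r..t} s * K r s) * (indicator {0<..<t} r * \<phi> r))"
      by (auto simp: F_def)
    have e2: "(\<lambda>s. norm (F r s)) =
        (\<lambda>s. (indicator {r..t} s * K r s) * (indicator {0<..<t} r * \<bar>\<phi> r\<bar>))"
      using pos by (auto simp: F_def abs_mult indicator_def fun_eq_iff)
    show "integral\<^sup>L lborel (F r) = indicator {0<..<t} r * ((t - r) powr b / b * \<phi> r)"
      unfolding e1 using Kint[of r] by (cases "r \<in> {0<..<t}") auto
    show "integral\<^sup>L lborel (\<lambda>s. norm (F r s))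
                 = indicator {0<..<t} r * ((t - r) powr b / b * \<bar>\<phi> r\<bar>)"
      unfolding e2 using Kint[of r] by (cases "r \<in> {0<..<t}") auto
    show "integrable lborel (F r)"
      unfolding e1 using Kint[of r] by (cases "r \<in> {0<..<t}") auto
  qed
  have bd: "integrable lborel (\<lambda>r. indicator {0<..<t} r * ((t - r) powr b / b * \<bar>\<phi> r\<bar>))"
  proof (rule Bochner_Integration.integrable_bound)
    show "integrable lborel (\<lambda>r. t powr b / b * \<phi> r)"
      using \<phi> by simp
    show "AE r in lborel. norm (indicator {0<..<t} r * ((t - r) powr b / b * \<bar>\<phi> r\<bar>))
            \<le> norm (t powr b / b * \<phi> r)"
      using b by (intro AE_I2)
        (auto simp: indicator_def abs_mult intro!: mult_right_mono divide_right_mono powr_mono2)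
  qed measurable
  have FI: "integrable (lborel \<Otimes>\<^sub>M lborel) (case_prod F)"
    by (rule lborel_pair.Fubini_integrable[OF Fm]) (use innern innerI bd in simp_all)
  have swap: "(\<integral>s. (\<integral>r. F r s \<partial>lborel) \<partial>lborel) =
      integral\<^sup>L lborel (\<lambda>r. indicator {0<..<t} r * ((t - r) powr b / b * \<phi> r))"
    using lborel_pair.Fubini_integral[OF FI] by (simp add: inner)
  have oI: "integrable lborel (\<lambda>s. \<integral>r. F r s \<partial>lborel)"
    using lborel_pair.integrable_snd[OF FI] by simp
  have sec: "AE s in lborel. integrable lborel (\<lambda>r. F r s)"
    using lborel_pair.AE_integrable_snd[OF FI] by simp
  have HI: "((\<lambda>s. \<integral>r. F r s \<partial>lborel) has_integral
      integral\<^sup>L lborel (\<lambda>r. indicator {0<..<t} r * ((t - r) powr b / b * \<phi> r))) UNIV"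
    using has_integral_integral_lborel[OF oI] swap by simp
  obtain N where N: "N \<in> null_sets lborel" "{s. \<not> integrable lborel (\<lambda>r. F r s)} \<subseteq> N"
    using sec by (auto elim!: AE_E simp: null_sets_def)
  have negN: "negligible (insert 0 (insert t N))"
    using N(1) by (auto simp: negligible_iff_null_sets intro!: null_sets_completionI)
  have eqs: "(if s \<in> {0..t} then integral {0..s} (\<lambda>r. K r s * \<phi> r) else 0) = (\<integral>r. F r s \<partial>lborel)"
    if s: "s \<in> UNIV - insert 0 (insert t N)" for s
  proof (cases "s \<in> {0..t}")
    case False
    then have "(\<lambda>r. F r s) = (\<lambda>r. 0)"
      by (auto simp: F_def indicator_def fun_eq_iff)
    then show ?thesis unfolding if_not_P[OF False] by simp
  next
    case True
    then have st: "0 < s" "s < t" using s by auto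
    have I: "integrable lborel (\<lambda>r. F r s)" using s N(2) by auto
    have e: "F r s = (if r \<in> {0<..s} then K r s * \<phi> r else 0)" for r
      using st by (auto simp: F_def indicator_def)
    have "((\<lambda>r. F r s) has_integral (\<integral>r. F r s \<partial>lborel)) UNIV"
      by (rule has_integral_integral_lborel[OF I])
    then have "((\<lambda>r. K r s * \<phi> r) has_integral (\<integral>r. F r s \<partial>lborel)) {0<..s}"
      unfolding e has_integral_restrict_UNIV .
    then have "((\<lambda>r. K r s * \<phi> r) has_integral (\<integral>r. F r s \<partial>lborel)) {0..s}"
      by (rule has_integral_spike_set_eq[THEN iffD1, rotated -1])
         (auto intro: negligible_subset[OF negligible_sing[of "0::real"]])
    then show ?thesis using True by (simp add: integral_unique)
  qed
  have "((\<lambda>s. if s \<in> {0..t} then integral {0..s} (\<lambda>r. K r s * \<phi> r) else 0) has_integral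
      integral\<^sup>L lborel (\<lambda>r. indicator {0<..<t} r * ((t - r) powr b / b * \<phi> r))) UNIV"
    by (rule has_integral_spike[OF negN _ HI]) (use eqs in simp)
  then show ?thesis
    by (simp only: has_integral_restrict_UNIV)
qed

lemma rl_kernel_left:
  assumes "0 < b" "r < (t::real)"
  shows "((\<lambda>s. (s - r) powr (b - 1)) has_integral (t - r) powr b / b) {r..t}"
proof -
  have "((\<lambda>s. (s - r) powr (b - 1)) has_integral (t - r) powr b / b - (r - r) powr b / b) {r..t}"
  proof (rule fundamental_theorem_of_calculus_interior)
    show "continuous_on {r..t} (\<lambda>s. (s - r) powr b / b)"
      using assms by (intro continuous_intros continuous_on_powr') auto
    show "((\<lambda>s. (s - r) powr b / b) has_vector_derivative (s - r) powr (b - 1)) (at s)" if "s \<in> {r<..<t}" for s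
      unfolding has_real_derivative_iff_has_vector_derivative[symmetric]
      using assms that by (auto intro!: derivative_eq_intros)
  qed (use assms in simp)
  then show ?thesis using assms by simp
qed

lemma rl_kernel_right:
  assumes "0 < b" "r < (t::real)"
  shows "((\<lambda>s. (t - s) powr (b - 1)) has_integral (t - r) powr b / b) {r..t}"
proof -
  have "((\<lambda>s. (t - s) powr (b - 1)) has_integral
      - ((t - t) powr b / b) - - ((t - r) powr b / b)) {r..t}"
  proof (rule fundamental_theorem_of_calculus_interior)
    show "continuous_on {r..t} (\<lambda>s. - ((t - s) powr b / b))"
      using assms by (intro continuous_intros continuous_on_powr') auto
    show "((\<lambda>s. - ((t - s) powr b / b)) has_vector_derivative (t - s) powr (b - 1)) (at s)" if "s \<in> {r<..<t}" for s
      unfolding has_real_derivative_iff_has_vector_derivative[symmetric]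
      using assms that by (auto intro!: derivative_eq_intros)
  qed (use assms in simp)
  then show ?thesis using assms by simp
qed

lemma rl_integral_commute:
  assumes b: "0 \<le> b" and t: "0 \<le> t" "t \<le> 1"
    and c: "continuous_on {0<..1} \<phi>" and i: "\<phi> absolutely_integrable_on {0..1}"
  shows "rl_integral b (\<lambda>s. integral {0..s} \<phi>) t = integral {0..t} (rl_integral b \<phi>)"
proof (cases "b = 0")
  case True
  then show ?thesis by (simp add: rl_integral_def [abs_def])
next
  case False
  then have b: "0 < b" using b by simp
  define \<psi> where "\<psi> = (\<lambda>r. indicator {0<..1} r *\<^sub>R \<phi> r)"
  have m: "\<psi> \<in> borel_measurable borel"
    unfolding \<psi>_def using borel_measurable_continuous_on_indicator[OF _ c] by simp
  have "\<phi> absolutely_integrable_on {0<..1}"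
    by (rule set_integrable_subset[OF i]) auto
  then have \<psi>: "integrable lborel \<psi>"
    using m unfolding set_integrable_def \<psi>_def by (subst (asm) integrable_completion) auto
  have sp: "integral {0..s} (\<lambda>r. w r * \<psi> r) = integral {0..s} (\<lambda>r. w r * \<phi> r)"
    if "s \<le> 1" for s and w :: "real \<Rightarrow> real"
    by (rule integral_spike[of "{0}"]) (use that in \<open>auto simp: \<psi>_def\<close>)
  let ?R = "integral\<^sup>L lborel (\<lambda>r. indicator {0<..<t} r * ((t - r) powr b / b * \<psi> r))"
  have 1: "((\<lambda>s. integral {0..s} (\<lambda>r. (s - r) powr (b - 1) * \<psi> r)) has_integral ?R) {0..t}"
    by (rule triangle_swap[OF t(1) b \<psi>, where K = "\<lambda>r s. (s - r) powr (b - 1)"])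
       (use rl_kernel_left[OF b] in auto)
  have 2: "((\<lambda>s. integral {0..s} (\<lambda>r. (t - s) powr (b - 1) * \<psi> r)) has_integral ?R) {0..t}"
    by (rule triangle_swap[OF t(1) b \<psi>, where K = "\<lambda>r s. (t - s) powr (b - 1)"])
       (use rl_kernel_right[OF b] in auto)
  have "integral {0..t} (\<lambda>s. integral {0..s} (\<lambda>r. (s - r) powr (b - 1) * \<phi> r)) = ?R"
    using integral_unique[OF 1] t
    by (subst Henstock_Kurzweil_Integration.integral_cong[OF sp[symmetric]]) auto
  moreover have "integral {0..t} (\<lambda>s. (t - s) powr (b - 1) * integral {0..s} \<phi>) = ?R"
    unfolding integral_unique[OF 2, symmetric]
    by (rule Henstock_Kurzweil_Integration.integral_cong)
       (use t sp[of _ "\<lambda>_. 1"] in simp)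
  ultimately show ?thesis
    using b by (simp add: rl_integral_def [abs_def])
qed

lemma has_caputo_derivative_classical:
  assumes \<zeta>: "1 < \<zeta>" "\<zeta> \<le> 2"
    and f: "\<And>t. t \<in> {0..1} \<Longrightarrow> (f has_real_derivative f' t) (at t within {0..1})"
    and cf': "continuous_on {0..1} f'"
    and f': "\<And>t. t \<in> {0<..1} \<Longrightarrow> (f' has_real_derivative f'' t) (at t within {0..1})"
    and f'': "continuous_on {0<..1} f''" "f'' absolutely_integrable_on {0..1}"
    and g: "continuous_on {0..1} g"
    and eq: "\<And>t. t \<in> {0<..1} \<Longrightarrow> rl_integral (2 - \<zeta>) f'' t = g t"
  shows "has_caputo_derivative \<zeta> f g"
proof -
  define b where "b = 2 - \<zeta>"
  have b: "0 \<le> b" using \<zeta> by (simp add: b_def)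
  define G where "G = (\<lambda>s. integral {0..s} f'')"
  have G: "G s = f' s - f' 0" if "s \<in> {0..1}" for s
  proof -
    have "(f'' has_integral f' s - f' 0) {0..s}"
    proof (rule fundamental_theorem_of_calculus_interior)
      show "continuous_on {0..s} f'"
        using cf' that by (auto intro: continuous_on_subset)
      show "(f' has_vector_derivative f'' x) (at x)" if "x \<in> {0<..<s}" for x
        using f'[of x] that \<open>s \<in> {0..1}\<close> at_within_Icc_at[of 0 x 1]
        by (simp flip: has_real_derivative_iff_has_vector_derivative)
    qed (use that in auto)
    then show ?thesis by (simp add: G_def integral_unique)
  qed
  have cG: "continuous_on {0..1} G"
    using continuous_on_cong[of "{0..1}" "{0..1}" G "\<lambda>s. f' s - f' 0"] G cf'
    by (auto intro!: continuous_intros)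
  have H: "integral {0..s} G = f s - f 0 - f' 0 * s" if s: "s \<in> {0..1}" for s
  proof -
    have "((\<lambda>x. f' x - f' 0) has_integral (f s - f' 0 * s) - (f 0 - f' 0 * 0)) {0..s}"
    proof (rule fundamental_theorem_of_calculus)
      show "((\<lambda>s. f s - f' 0 * s) has_vector_derivative f' x - f' 0) (at x within {0..s})"
        if "x \<in> {0..s}" for x
      proof -
        have "(f has_real_derivative f' x) (at x within {0..s})"
          using f[of x] that s by (auto intro: DERIV_subset)
        then show ?thesis
          by (auto intro!: derivative_eq_intros
              simp flip: has_real_derivative_iff_has_vector_derivative)
      qed
    qed (use s in auto)
    moreover have "integral {0..s} G = integral {0..s} (\<lambda>x. f' x - f' 0)"
      by (rule Henstock_Kurzweil_Integration.integral_cong) (use G s in auto)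
    ultimately show ?thesis by (simp add: integral_unique)
  qed
  have i1: "integral {0..t} (rl_integral b f'') = integral {0..t} g" if "t \<in> {0..1}" for t
    by (rule integral_spike[of "{0}"]) (use eq that in \<open>auto simp: b_def\<close>)
  have rG: "rl_integral b G s = integral {0..s} g" if "s \<in> {0..1}" for s
    using rl_integral_commute[OF b _ _ f'', of s] i1[OF that] that by (simp add: G_def)
  have J: "rl_integral b (\<lambda>s. f s - f 0 - f' 0 * s) t = integral {0..t} (\<lambda>s. integral {0..s} g)"
    if t: "t \<in> {0..1}" for t
  proof -
    have "rl_integral b (\<lambda>s. f s - f 0 - f' 0 * s) t = rl_integral b (\<lambda>s. integral {0..s} G) t"
      using H t
      by (auto simp: rl_integral_def intro!: Henstock_Kurzweil_Integration.integral_cong)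
    also have "\<dots> = integral {0..t} (rl_integral b G)"
      using t cG by (intro rl_integral_commute b)
        (auto intro: continuous_on_subset absolutely_integrable_continuous_real)
    also have "\<dots> = integral {0..t} (\<lambda>s. integral {0..s} g)"
      by (rule Henstock_Kurzweil_Integration.integral_cong) (use rG t in auto)
    finally show ?thesis .
  qed
  have cg: "continuous_on {0..1} (\<lambda>s. integral {0..s} g)"
    by (intro indefinite_integral_continuous_1 integrable_continuous_real g)
  have "(rl_integral b (\<lambda>s. f s - f 0 - f' 0 * s) has_real_derivative integral {0..t} g)
      (at t within {0..1})" if "t \<in> {0..1}" for t
    by (rule has_field_derivative_transform_within
          [OF integral_has_real_derivative[OF cg that] zero_less_one that]) (simp add: J)
  moreover have "((\<lambda>s. integral {0..s} g) has_real_derivative g t) (at t within {0..1})"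
    if "t \<in> {0..1}" for t
    by (rule integral_has_real_derivative[OF g that])
  ultimately show ?thesis
    unfolding has_caputo_derivative_def b_def[symmetric] using f[of 0]
    by (intro exI[of _ "f' 0"] exI[of _ "\<lambda>s. integral {0..s} g"]) auto
qed

end

theory Submission
  imports Defs
begin

text \<open>
  The boundary value problem is turned into a fixed point equation with a contracting right-hand
  side. If \<open>D\<^sup>\<zeta> f = H\<close> and \<open>f(0) = 0\<close>, then \<open>f(t) = I\<^sup>\<zeta> H(t) + d t\<close> with \<open>d = f'(0)\<close>. Integrating
  over \<open>[0,1]\<close>, the condition \<open>I f(1) = d\<close> reads \<open>\<integral>\<^sub>0\<^sup>1 I\<^sup>\<zeta> H + d/2 = d\<close>, so \<open>d = 2 \<integral>\<^sub>0\<^sup>1 I\<^sup>\<zeta> H\<close>.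
  Hence a solution is a fixed point of
  \<open>T u (t) = P u (t) + 2 t \<integral>\<^sub>0\<^sup>1 P u\<close>, where \<open>P u = I\<^sup>\<zeta> (h(\<cdot>, u(\<cdot>)))\<close>.

  The operator \<open>I\<^sup>\<zeta>\<close> has sup norm at most \<open>1 / \<Gamma>(\<zeta> + 1) \<le> 1\<close> on \<open>C[0,1]\<close>
  (\<open>abs_rl_integral_le\<close>). Therefore, if \<open>h\<close> is Lipschitz in its second variable with constant
  \<open>L\<close>, then \<open>T\<close> is Lipschitz with constant \<open>L + 2 L = 3 L\<close>. Constant functions \<open>u\<close> and \<open>v\<close> in
  hypothesis (ii) give \<open>L = \<alpha> \<Gamma>(\<alpha> + 1) / 4\<close>, and \<open>\<Gamma> \<le> 1\<close> on \<open>[1,2]\<close> makes \<open>3 L < 1\<close>. Banach's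
  theorem yields the fixed point.

  Conversely, that a fixed point solves the equation in the Caputo sense
  (\<open>has_caputo_derivative_rl_integral\<close>) rests on the semigroup law \<open>I\<^sup>a I\<^sup>b = I\<^bsup>a+b\<^esup>\<close>
  (\<open>rl_integral_semigroup\<close>): it gives \<open>I\<^bsup>2-\<zeta>\<^esup> I\<^sup>\<zeta> H = I\<^sup>2 H = I\<^sup>1 I\<^sup>1 H\<close>, an iterated ordinary integral,
  whose second derivative is \<open>H\<close>. That \<open>d\<close> is really \<open>f'(0)\<close> follows from \<open>I\<^sup>\<zeta> H(t) = O(t\<^sup>\<zeta>)\<close> and
  \<open>\<zeta> > 1\<close>.
\<close>

section \<open>Bounds for the Gamma function\<close>

lemma convex_on_ln_Gamma: "convex_on {0<..} (\<lambda>x::real. ln (Gamma x))"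
  using log_convex_Gamma_real by (simp add: o_def)

text \<open>
  Both bounds are instances of the convexity of \<open>ln \<circ> \<Gamma>\<close>, which vanishes at \<open>1\<close> and at \<open>2\<close>: a
  convex function is at most \<open>0\<close> between two zeros and at least \<open>0\<close> outside.
\<close>

lemma Gamma_real_le_1:
  fixes x :: real
  assumes "1 \<le> x" "x \<le> 2"
  shows "Gamma x \<le> 1"
proof -
  have "ln (Gamma ((1 - (x - 1)) *\<^sub>R 1 + (x - 1) *\<^sub>R 2))
      \<le> (1 - (x - 1)) * ln (Gamma 1) + (x - 1) * ln (Gamma (2::real))"
    using assms by (intro convex_onD[OF convex_on_ln_Gamma]) auto
  moreover have "(1 - (x - 1)) *\<^sub>R 1 + (x - 1) *\<^sub>R 2 = x"
    by (simp add: algebra_simps)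
  ultimately have "ln (Gamma x) \<le> 0"
    using Gamma_fact[of 1, where ?'a = real] by simp
  then show ?thesis
    using assms Gamma_real_pos[of x] by simp
qed

lemma Gamma_real_ge_1:
  fixes x :: real
  assumes "2 \<le> x"
  shows "1 \<le> Gamma x"
proof -
  \<comment> \<open>The weight that writes \<open>2\<close> as a convex combination of \<open>1\<close> and \<open>x\<close>.\<close>
  define t where "t = 1 / (x - 1)"
  have t: "0 < t" "t \<le> 1" and tx: "t * (x - 1) = 1"
    using assms by (auto simp: t_def)
  have "ln (Gamma ((1 - t) *\<^sub>R 1 + t *\<^sub>R x)) \<le> (1 - t) * ln (Gamma 1) + t * ln (Gamma x)"
    using assms t by (intro convex_onD[OF convex_on_ln_Gamma]) auto
  moreover have "1 - t + t * x = 2"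
    using tx by (simp add: algebra_simps)
  ultimately have "0 \<le> t * ln (Gamma x)"
    using Gamma_fact[of 1, where ?'a = real] by simp
  then have "0 \<le> ln (Gamma x)"
    using t by (simp add: zero_le_mult_iff)
  then show ?thesis
    using assms Gamma_real_pos[of x] by simp
qed

section \<open>The Riemann--Liouville integral of a continuous function\<close>

lemma rl_integral_integrable:
  fixes \<zeta> t :: real and f :: "real \<Rightarrow> real"
  assumes "1 \<le> \<zeta>" "continuous_on {0..t} f"
  shows "(\<lambda>s. (t - s) powr (\<zeta> - 1) * f s) integrable_on {0..t}"
proof (cases "\<zeta> = 1")
  case True
  \<comment> \<open>Since \<open>0 powr 0 = 0\<close>, the integrand differs from \<open>f\<close> at \<open>s = t\<close>.\<close>
  then show ?thesis
    using integrable_continuous_real[OF assms(2)]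
    by (elim integrable_spike_finite[of "{t}", rotated 2]) auto
next
  case False
  then show ?thesis
    using assms by (intro integrable_continuous_real continuous_intros continuous_on_powr') auto
qed

lemma rl_integral_cong:
  assumes t: "0 \<le> t" and eq: "\<And>s. s \<in> {0..t} \<Longrightarrow> f s = g s"
  shows "rl_integral \<zeta> f t = rl_integral \<zeta> g t"
proof -
  have "integral {0..t} (\<lambda>s. (t - s) powr (\<zeta> - 1) * f s)
      = integral {0..t} (\<lambda>s. (t - s) powr (\<zeta> - 1) * g s)"
    by (rule Henstock_Kurzweil_Integration.integral_cong) (simp add: eq)
  then show ?thesis
    using eq[of t] t by (simp add: rl_integral_def)
qed

lemma rl_integral_1: "rl_integral 1 f t = integral {0..t} f"
  unfolding rl_integral_def by (simp, rule integral_spike[of "{t}"]) auto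

lemma rl_integral_diff:
  assumes "1 \<le> \<zeta>" "continuous_on {0..t} f" "continuous_on {0..t} g"
  shows "rl_integral \<zeta> f t - rl_integral \<zeta> g t = rl_integral \<zeta> (\<lambda>s. f s - g s) t"
  using assms(1) unfolding rl_integral_def
  by (simp add: right_diff_distrib
      Henstock_Kurzweil_Integration.integral_diff rl_integral_integrable assms)

text \<open>
  The kernel integrates to \<open>t powr \<zeta> / \<zeta>\<close>, and \<open>\<zeta> * Gamma \<zeta> = Gamma (\<zeta> + 1) \<ge> 1\<close>. The estimate is
  used twice: at \<open>t \<le> 1\<close> for the contraction, and as \<open>t\<close> tends to \<open>0\<close> for the derivative there.
\<close>

lemma abs_rl_integral_le:
  assumes \<zeta>: "1 \<le> \<zeta>" and t: "0 \<le> t" and f: "continuous_on {0..t} f"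
    and M: "\<And>s. s \<in> {0..t} \<Longrightarrow> \<bar>f s\<bar> \<le> M"
  shows "\<bar>rl_integral \<zeta> f t\<bar> \<le> M * t powr \<zeta>"
proof (cases "t = 0")
  case True
  then show ?thesis using \<zeta> by (simp add: rl_integral_def)
next
  case False
  have M0: "0 \<le> M" using M[of 0] t by auto
  have K: "((\<lambda>s. (t - s) powr (\<zeta> - 1)) has_integral t powr \<zeta> / \<zeta>) {0..t}"
    using rl_kernel_right[of \<zeta> 0 t] False t \<zeta> by simp
  have "norm (integral {0..t} (\<lambda>s. (t - s) powr (\<zeta> - 1) * f s))
      \<le> integral {0..t} (\<lambda>s. (t - s) powr (\<zeta> - 1) * M)"
    using K M
    by (intro Henstock_Kurzweil_Integration.integral_norm_bound_integral rl_integral_integrable \<zeta> f)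
       (auto simp: abs_mult intro!: mult_left_mono integrable_on_mult_left)
  also have "\<dots> = t powr \<zeta> / \<zeta> * M"
    by (rule integral_unique[OF has_integral_mult_left[OF K]])
  finally have "1 / Gamma \<zeta> * norm (integral {0..t} (\<lambda>s. (t - s) powr (\<zeta> - 1) * f s))
      \<le> 1 / Gamma \<zeta> * (t powr \<zeta> / \<zeta> * M)"
    using \<zeta> Gamma_real_pos[of \<zeta>] by (intro mult_left_mono) auto
  moreover have "\<bar>rl_integral \<zeta> f t\<bar>
      = 1 / Gamma \<zeta> * norm (integral {0..t} (\<lambda>s. (t - s) powr (\<zeta> - 1) * f s))"
    using \<zeta> Gamma_real_pos[of \<zeta>] by (simp add: rl_integral_def abs_mult)
  ultimately have "\<bar>rl_integral \<zeta> f t\<bar> \<le> 1 / Gamma \<zeta> * (t powr \<zeta> / \<zeta> * M)"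
    by simp
  also have "\<dots> = M * t powr \<zeta> / Gamma (\<zeta> + 1)"
    using \<zeta> by (subst Gamma_plus1) (auto elim!: nonpos_Ints_cases simp: mult.commute)
  also have "\<dots> \<le> M * t powr \<zeta> / 1"
    using M0 Gamma_real_ge_1[of "\<zeta> + 1"] \<zeta> by (intro divide_left_mono) auto
  finally show ?thesis by simp
qed

text \<open>
  Replacing \<open>t - s\<close> by its positive part makes the domain of integration independent of \<open>t\<close>
  without losing continuity of the integrand, because \<open>\<zeta> - 1 > 0\<close>. Continuity of integrals with
  a parameter then applies.
\<close>

lemma continuous_on_rl_integral:
  assumes \<zeta>: "1 < \<zeta>" and f: "continuous_on {0..c} f"
  shows "continuous_on {0..c} (rl_integral \<zeta> f)"
proof -
  have "continuous_on ({0..c} \<times> cbox 0 c)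
      (\<lambda>(t, s). max 0 (t - s) powr (\<zeta> - 1) * f s)"
    unfolding case_prod_unfold using \<zeta>
    by (intro continuous_intros continuous_on_powr' continuous_on_compose2[OF f]) auto
  then have "continuous_on {0..c}
      (\<lambda>t. 1 / Gamma \<zeta> * integral (cbox 0 c) (\<lambda>s. max 0 (t - s) powr (\<zeta> - 1) * f s))"
    by (intro continuous_intros integral_continuous_on_param)
  moreover have "1 / Gamma \<zeta> * integral (cbox 0 c) (\<lambda>s. max 0 (t - s) powr (\<zeta> - 1) * f s)
      = rl_integral \<zeta> f t" if t: "t \<in> {0..c}" for t
  proof -
    have "integral {0..c} (\<lambda>s. max 0 (t - s) powr (\<zeta> - 1) * f s)
        = integral {0..c} (\<lambda>s. if s \<in> {0..t} then (t - s) powr (\<zeta> - 1) * f s else 0)"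
      by (rule Henstock_Kurzweil_Integration.integral_cong) auto
    also have "\<dots> = integral {0..t} (\<lambda>s. (t - s) powr (\<zeta> - 1) * f s)"
      using t by (subst integral_restrict_Int) (simp add: Int_absorb2)
    finally show ?thesis
      using \<zeta> by (simp add: rl_integral_def)
  qed
  ultimately show ?thesis
    using continuous_on_eq by blast
qed

lemma rl_integral_deriv_0:
  assumes \<zeta>: "1 < \<zeta>" and c: "0 \<le> c" and f: "continuous_on {0..c} f"
  shows "(rl_integral \<zeta> f has_real_derivative 0) (at 0 within {0..c})"
proof -
  have "bounded (f ` {0..c})"
    by (intro compact_imp_bounded compact_continuous_image f compact_Icc)
  then obtain M where "\<forall>x\<in>f ` {0..c}. norm x \<le> M"
    unfolding bounded_iff ..
  then have M: "\<bar>f s\<bar> \<le> M" if "s \<in> {0..c}" for s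
    using that by auto
  have bd: "norm (rl_integral \<zeta> f t / t) \<le> M * t powr (\<zeta> - 1)" if "t \<in> {0..c}" "t \<noteq> 0" for t
  proof -
    have "\<bar>rl_integral \<zeta> f t\<bar> \<le> M * t powr \<zeta>"
      using that M \<zeta> by (intro abs_rl_integral_le continuous_on_subset[OF f]) auto
    also have "t powr \<zeta> = t powr (\<zeta> - 1) * t"
      using that powr_add[of t "\<zeta> - 1" 1] by simp
    finally show ?thesis
      using that by (simp add: field_simps)
  qed
  have "((\<lambda>t. M * t powr (\<zeta> - 1)) \<longlongrightarrow> M * 0 powr (\<zeta> - 1)) (at 0 within {0..c})"
    using \<zeta> by (intro tendsto_intros tendsto_powr') (auto simp: eventually_at_filter)
  then have lim: "((\<lambda>t. M * t powr (\<zeta> - 1)) \<longlongrightarrow> 0) (at 0 within {0..c})"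
    using \<zeta> by simp
  have "eventually (\<lambda>t. norm (rl_integral \<zeta> f t / t) \<le> M * t powr (\<zeta> - 1)) (at 0 within {0..c})"
    unfolding eventually_at_filter using bd by (intro always_eventually) blast
  then have "((\<lambda>t. rl_integral \<zeta> f t / t) \<longlongrightarrow> 0) (at 0 within {0..c})"
    using lim by (rule Lim_null_comparison)
  then show ?thesis
    using \<zeta> by (simp add: has_field_derivative_iff rl_integral_def)
qed

text \<open>
  The Beta integral, carried from \<open>[0,1]\<close> to \<open>[r,t]\<close> by the substitution \<open>x \<mapsto> (x - r) / (t - r)\<close>.
\<close>

lemma rl_kernel_convolution:
  fixes a b r t :: real
  assumes a: "0 < a" and b: "0 < b" and rt: "r < t"
  shows "((\<lambda>s. (t - s) powr (a - 1) * (s - r) powr (b - 1)) has_integral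
      Beta b a * (t - r) powr (a + b - 1)) {r..t}"
proof -
  define d where "d = t - r"
  have d: "0 < d" using rt by (simp add: d_def)
  have "((\<lambda>x. ((1/d) *\<^sub>R x + (- r/d)) powr (b - 1) * (1 - ((1/d) *\<^sub>R x + (- r/d))) powr (a - 1))
     has_integral (Beta b a /\<^sub>R (1/d) ^ DIM(real)))
       (cbox ((0 - (- r/d)) /\<^sub>R (1/d)) ((1 - (- r/d)) /\<^sub>R (1/d)))"
    using has_integral_Beta_real[OF b a] d by (intro has_integral_affinity') auto
  moreover have "(0 - (- r/d)) /\<^sub>R (1/d) = r" "(1 - (- r/d)) /\<^sub>R (1/d) = t"
  proof -
    show "(0 - (- r/d)) /\<^sub>R (1/d) = r" using d by simp
    have "(1 - (- r/d)) /\<^sub>R (1/d) = d + r" using d by (simp add: distrib_left)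
    then show "(1 - (- r/d)) /\<^sub>R (1/d) = t" by (simp add: d_def)
  qed
  moreover have "Beta b a /\<^sub>R (1/d) ^ DIM(real) = Beta b a * d"
    by (simp add: field_simps)
  ultimately have "((\<lambda>x. ((x - r) / d) powr (b - 1) * (1 - (x - r) / d) powr (a - 1))
     has_integral Beta b a * d) {r..t}"
    by (simp add: diff_divide_distrib mult.commute[of "Beta b a" d])
  then have I: "((\<lambda>x. d powr (a + b - 2) *
      (((x - r) / d) powr (b - 1) * (1 - (x - r) / d) powr (a - 1)))
     has_integral d powr (a + b - 2) * (Beta b a * d)) {r..t}"
    by (rule has_integral_mult_right)
  have eq: "d powr (a + b - 2) * (((x - r) / d) powr (b - 1) * (1 - (x - r) / d) powr (a - 1))
      = (t - x) powr (a - 1) * (x - r) powr (b - 1)" if x: "x \<in> {r..t}" for x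
  proof -
    have "1 - (x - r) / d = (t - x) / d"
      using d by (simp add: field_simps d_def)
    moreover have "d powr (a + b - 2) = d powr (a - 1) * d powr (b - 1)"
      by (simp flip: powr_add add: algebra_simps)
    ultimately show ?thesis
      using x d by (simp add: powr_divide)
  qed
  have "d powr (a + b - 2) * (Beta b a * d) = Beta b a * d powr (a + b - 1)"
    using d powr_add[of d "a + b - 2" 1] by simp
  then show ?thesis
    using has_integral_eq[OF eq I] unfolding d_def by (simp only:)
qed

text \<open>
  Interchanging the two integrations over the triangle \<open>0 \<le> r \<le> s \<le> t\<close> leaves the inner integral
  of the product of both kernels over \<open>s \<in> [r,t]\<close>, a Beta integral equal to the kernel of order
  \<open>a + b\<close> up to Gamma factors. With \<open>a + b > 1\<close> this kernel is continuous, also where \<open>r = t\<close>.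
\<close>

theorem rl_integral_semigroup:
  assumes a: "0 \<le> a" and b: "0 < b" and ab: "1 < a + b" and t: "0 \<le> t"
    and f: "continuous_on {0..t} f"
  shows "rl_integral a (rl_integral b f) t = rl_integral (a + b) f t"
proof (cases "a = 0")
  case True
  then show ?thesis by (simp add: rl_integral_def)
next
  case False
  then have a: "0 < a" using a by simp
  \<comment> \<open>Normalises the product of the two kernels to the form that \<open>triangle_swap\<close> expects.\<close>
  define B where "B = Beta b a * (a + b - 1)"
  have Beta: "Beta b a = Gamma a * Gamma b / Gamma (a + b)"
    by (simp add: Beta_def ac_simps)
  have G: "0 < Gamma a" "0 < Gamma b" "0 < Gamma (a + b)"
    using a b by (auto intro: Gamma_real_pos)
  have B: "0 < B"
    using G ab by (simp add: B_def Beta)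
  define \<psi> where "\<psi> = (\<lambda>r. indicator {0..t} r *\<^sub>R f r)"
  have \<psi>: "integrable lborel \<psi>"
    using borel_integrable_compact[OF compact_Icc f] by (simp add: \<psi>_def)
  define K where "K = (\<lambda>r s. (t - s) powr (a - 1) * (s - r) powr (b - 1) / B)"
  have K: "(K r has_integral (t - r) powr (a + b - 1) / (a + b - 1)) {r..t}" if "r < t" for r
    using has_integral_divide[OF rl_kernel_convolution[OF a b that], of B] G ab
    by (simp add: K_def B_def Beta)
  have "((\<lambda>s. integral {0..s} (\<lambda>r. K r s * \<psi> r)) has_integral
      integral\<^sup>L lborel (\<lambda>r. indicator {0<..<t} r *
        ((t - r) powr (a + b - 1) / (a + b - 1) * \<psi> r))) {0..t}"
    using B K ab by (intro triangle_swap[OF t _ \<psi>]) (auto simp: K_def)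
  moreover have "integral\<^sup>L lborel (\<lambda>r. indicator {0<..<t} r *
        ((t - r) powr (a + b - 1) / (a + b - 1) * \<psi> r))
      = integral {0..t} (\<lambda>r. (t - r) powr (a + b - 1) * f r) / (a + b - 1)" (is "?L = _")
  proof -
    let ?g = "\<lambda>r. (t - r) powr (a + b - 1) * f r"
    have "continuous_on {0..t} ?g"
      using ab f by (intro continuous_intros continuous_on_powr') auto
    then have "set_integrable lborel {0..t} ?g"
      unfolding set_integrable_def by (rule borel_integrable_compact[OF compact_Icc])
    then have si: "set_integrable lborel {0<..<t} ?g"
      by (rule set_integrable_subset) auto
    have "?L = integral\<^sup>L lborel (\<lambda>r. indicator {0<..<t} r *\<^sub>R ?g r / (a + b - 1))"
      by (rule Bochner_Integration.integral_cong) (auto simp: \<psi>_def indicator_def)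
    also have "\<dots> = integral {0<..<t} ?g / (a + b - 1)"
      using set_borel_integral_eq_integral(2)[OF si]
      by (simp add: set_lebesgue_integral_def)
    finally show ?thesis
      by (simp add: integral_open_interval_real)
  qed
  ultimately have I: "((\<lambda>s. integral {0..s} (\<lambda>r. K r s * \<psi> r)) has_integral
      integral {0..t} (\<lambda>r. (t - r) powr (a + b - 1) * f r) / (a + b - 1)) {0..t}"
    by (simp only:)
  have "integral {0..s} (\<lambda>r. K r s * \<psi> r)
      = (Gamma b / B) * ((t - s) powr (a - 1) * rl_integral b f s)" if s: "s \<in> {0..t}" for s
  proof -
    have "integral {0..s} (\<lambda>r. K r s * \<psi> r)
        = integral {0..s} (\<lambda>r. (t - s) powr (a - 1) / B * ((s - r) powr (b - 1) * f r))"
      using s by (intro Henstock_Kurzweil_Integration.integral_cong) (auto simp: K_def \<psi>_def)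
    then show ?thesis
      using b G(2)[THEN less_imp_neq] by (simp add: rl_integral_def)
  qed
  then have "((\<lambda>s. (Gamma b / B) * ((t - s) powr (a - 1) * rl_integral b f s)) has_integral
      integral {0..t} (\<lambda>r. (t - r) powr (a + b - 1) * f r) / (a + b - 1)) {0..t}"
    using I by (rule has_integral_eq)
  from integral_unique[OF has_integral_mult_right[OF this, of "B / (Gamma a * Gamma b)"]]
  have "integral {0..t} (\<lambda>s. 1 / Gamma a * ((t - s) powr (a - 1) * rl_integral b f s))
     = B / (Gamma a * Gamma b) *
        (integral {0..t} (\<lambda>r. (t - r) powr (a + b - 1) * f r) / (a + b - 1))"
    using G B by simp
  moreover have "B / (Gamma a * Gamma b) = (a + b - 1) / Gamma (a + b)"
    using G by (simp add: B_def Beta)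
  ultimately show ?thesis
    using a b ab by (simp add: rl_integral_def)
qed

section \<open>Solving the linear problem\<close>

text \<open>
  Once the Taylor polynomial \<open>e + d t\<close> is removed, \<open>f\<close> is \<open>I\<^sup>\<zeta> g\<close>, and the semigroup law, used
  twice, turns \<open>I\<^bsup>2-\<zeta>\<^esup> I\<^sup>\<zeta> g = I\<^sup>2 g\<close> into the twofold ordinary integral of the continuous function
  \<open>g\<close>.
\<close>

theorem has_caputo_derivative_rl_integral:
  assumes \<zeta>: "1 < \<zeta>" "\<zeta> \<le> 2"
    and g: "continuous_on {0..1} g"
    and f: "\<And>t. t \<in> {0..1} \<Longrightarrow> f t = rl_integral \<zeta> g t + d * t + e"
  shows "has_caputo_derivative \<zeta> f g"
    and "(f has_real_derivative d) (at 0 within {0..1})"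
proof -
  have "((\<lambda>t. rl_integral \<zeta> g t + d * t + e) has_real_derivative d) (at 0 within {0..1})"
    using rl_integral_deriv_0[OF \<zeta>(1) _ g]
    by (auto intro!: derivative_eq_intros)
  then show f': "(f has_real_derivative d) (at 0 within {0..1})"
    using zero_less_one
    by (rule has_field_derivative_transform_within) (simp_all add: f)
  have g': "continuous_on {0..t} g" if "t \<in> {0..1}" for t
    using that by (intro continuous_on_subset[OF g]) auto
  have cG: "continuous_on {0..1} (\<lambda>s. integral {0..s} g)"
    by (intro indefinite_integral_continuous_1 integrable_continuous_real g)
  have J: "rl_integral (2 - \<zeta>) (\<lambda>s. f s - f 0 - d * s) t
      = integral {0..t} (\<lambda>s. integral {0..s} g)" if t: "t \<in> {0..1}" for t
  proof -
    have t0: "0 \<le> t" using t by simp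
    have f0: "f 0 = e" using f[of 0] \<zeta> by (simp add: rl_integral_def)
    have "f s - f 0 - d * s = rl_integral \<zeta> g s" if "s \<in> {0..t}" for s
      using f[of s] that t by (simp add: f0)
    then have "rl_integral (2 - \<zeta>) (\<lambda>s. f s - f 0 - d * s) t
        = rl_integral (2 - \<zeta>) (rl_integral \<zeta> g) t"
      by (rule rl_integral_cong[OF t0])
    also have "\<dots> = rl_integral 2 g t"
      using rl_integral_semigroup[of "2 - \<zeta>" \<zeta> t g] \<zeta> t g'[OF t] by simp
    also have "\<dots> = rl_integral 1 (rl_integral 1 g) t"
      using rl_integral_semigroup[of 1 1 t g] t g'[OF t] by simp
    finally show ?thesis
      by (simp add: rl_integral_1[abs_def])
  qed
  have "(rl_integral (2 - \<zeta>) (\<lambda>s. f s - f 0 - d * s) has_real_derivative integral {0..t} g)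
      (at t within {0..1})" if "t \<in> {0..1}" for t
    by (rule has_field_derivative_transform_within
          [OF integral_has_real_derivative[OF cG that] zero_less_one that]) (simp add: J)
  moreover have "((\<lambda>s. integral {0..s} g) has_real_derivative g t) (at t within {0..1})"
    if "t \<in> {0..1}" for t
    by (rule integral_has_real_derivative[OF g that])
  ultimately show "has_caputo_derivative \<zeta> f g"
    unfolding has_caputo_derivative_def using f'
    by (intro exI[of _ d] exI[of _ "\<lambda>s. integral {0..s} g"] conjI ballI)
qed

section \<open>Existence by the contraction principle\<close>

text \<open>
  Banach's theorem on \<open>C[a,b]\<close> for operators given on plain functions. A function on \<open>[a,b]\<close> is
  represented in the complete space of bounded continuous functions on the line by its extension
  that is constant on either side of \<open>[a,b]\<close>.
\<close>

lemma contraction_fixed_point_Icc: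
  fixes T :: "(real \<Rightarrow> 'a::banach) \<Rightarrow> real \<Rightarrow> 'a"
  assumes ab: "a \<le> b" and c: "0 \<le> c" "c < 1"
    and T: "\<And>u. continuous_on {a..b} u \<Longrightarrow> continuous_on {a..b} (T u)"
    and contr: "\<And>u v M t. \<lbrakk>continuous_on {a..b} u; continuous_on {a..b} v;
        \<And>s. s \<in> {a..b} \<Longrightarrow> dist (u s) (v s) \<le> M; t \<in> {a..b}\<rbrakk>
      \<Longrightarrow> dist (T u t) (T v t) \<le> c * M"
  obtains u where "continuous_on {a..b} u" "\<And>t. t \<in> {a..b} \<Longrightarrow> u t = T u t"
proof -
  have "\<exists>g :: real \<Rightarrow>\<^sub>C 'a. \<forall>x. g x = T u (clamp a b x)" for u :: "real \<Rightarrow>\<^sub>C 'a"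
  proof -
    have "continuous_on (cbox a b) (T u)" using T by simp
    then show ?thesis by (rule continuous_on_cbox_bcontfunE) blast
  qed
  then obtain \<Phi> :: "(real \<Rightarrow>\<^sub>C 'a) \<Rightarrow> (real \<Rightarrow>\<^sub>C 'a)"
    where \<Phi>: "\<And>u x. \<Phi> u x = T u (clamp a b x)" by metis
  have clamp: "clamp a b x \<in> {a..b}" for x
    using clamp_in_interval[of a b x] ab by simp
  have "dist (\<Phi> u) (\<Phi> v) \<le> c * dist u v" for u v
    by (rule dist_bound) (auto simp: \<Phi> intro!: contr clamp dist_bounded)
  then obtain u where u: "\<Phi> u = u"
    using banach_fix_type[OF c, of \<Phi>] by blast
  show ?thesis
  proof
    show "continuous_on {a..b} u" by simp
    show "u t = T u t" if "t \<in> {a..b}" for t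
      using \<Phi>[of u t] that by (simp add: u)
  qed
qed

text \<open>
  The factor \<open>3\<close> is the Lipschitz constant that \<open>T\<close> inherits: one from \<open>P u (t)\<close> and two from
  \<open>2 t \<integral>\<^sub>0\<^sup>1 P u\<close>.
\<close>

theorem caputo_integral_bvp_exists:
  fixes \<zeta> L :: real and h :: "real \<Rightarrow> real \<Rightarrow> real"
  assumes \<zeta>: "1 < \<zeta>" "\<zeta> \<le> 2"
    and cont: "continuous_on ({0..1} \<times> UNIV) (\<lambda>(t, x). h t x)"
    and L: "3 * L < 1"
    and lip: "\<And>t x y. t \<in> {0..1} \<Longrightarrow> x \<le> y \<Longrightarrow> \<bar>h t x - h t y\<bar> \<le> L * \<bar>x - y\<bar>"
  shows "\<exists>f. continuous_on {0..1} f \<and>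
           has_caputo_derivative \<zeta> f (\<lambda>t. h t (f t)) \<and>
           f 0 = 0 \<and>
           (f has_real_derivative rl_integral 1 f 1) (at 0 within {0..1})"
proof -
  have "\<bar>h 0 0 - h 0 1\<bar> \<le> L" using lip[of 0 0 1] by simp
  then have L0: "0 \<le> L" by linarith
  have lip': "\<bar>h t x - h t y\<bar> \<le> L * \<bar>x - y\<bar>" if "t \<in> {0..1}" for t x y
    using lip[OF that, of x y] lip[OF that, of y x]
    by (cases "x \<le> y") (auto simp: abs_minus_commute)
  define P where "P = (\<lambda>u. rl_integral \<zeta> (\<lambda>s. h s (u s)))"
  define T where "T = (\<lambda>u t. P u t + 2 * integral {0..1} (P u) * t)"
  have ch: "continuous_on {0..1} (\<lambda>s. h s (u s))" if "continuous_on {0..1} u" for u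
    using continuous_on_compose2[OF cont continuous_on_Pair[OF continuous_on_id that]]
    by auto
  have cP: "continuous_on {0..1} (P u)" if "continuous_on {0..1} u" for u
    unfolding P_def by (intro continuous_on_rl_integral \<zeta> ch that)
  have cT: "continuous_on {0..1} (T u)" if "continuous_on {0..1} u" for u
    unfolding T_def by (intro continuous_intros cP that)
  have P: "\<bar>P u t - P v t\<bar> \<le> L * M"
    if u: "continuous_on {0..1} u" and v: "continuous_on {0..1} v"
      and M: "\<And>s. s \<in> {0..1} \<Longrightarrow> \<bar>u s - v s\<bar> \<le> M" and t: "t \<in> {0..1}" for u v M t
  proof -
    have sub: "{0..t} \<subseteq> {0..1}" using t by auto
    have M0: "0 \<le> M" using M[of 0] by auto
    have "\<bar>P u t - P v t\<bar> = \<bar>rl_integral \<zeta> (\<lambda>s. h s (u s) - h s (v s)) t\<bar>"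
      unfolding P_def using \<zeta>
      by (subst rl_integral_diff) (auto intro: continuous_on_subset[OF ch sub] u v)
    also have "\<dots> \<le> L * M * t powr \<zeta>"
    proof (rule abs_rl_integral_le)
      show "\<bar>h s (u s) - h s (v s)\<bar> \<le> L * M" if "s \<in> {0..t}" for s
        using lip'[of s "u s" "v s"] mult_left_mono[OF M L0, of s] that sub by force
    qed (use \<zeta> t in \<open>auto intro!: continuous_intros continuous_on_subset[OF ch sub] u v\<close>)
    also have "\<dots> \<le> L * M * 1"
      using t \<zeta> L0 M0 by (intro mult_left_mono powr_le1) auto
    finally show ?thesis by simp
  qed
  have contr: "\<bar>T u t - T v t\<bar> \<le> 3 * L * M"
    if u: "continuous_on {0..1} u" and v: "continuous_on {0..1} v"
      and M: "\<And>s. s \<in> {0..1} \<Longrightarrow> \<bar>u s - v s\<bar> \<le> M" and t: "t \<in> {0..1}" for u v M t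
  proof -
    note uv = P[OF u v M]
    have I: "\<bar>integral {0..1} (P u) - integral {0..1} (P v)\<bar> \<le> L * M"
    proof -
      have "norm (integral {0..1} (\<lambda>s. P u s - P v s)) \<le> L * M * (1 - 0)"
        by (rule integral_bound) (use uv in \<open>auto intro!: continuous_intros cP u v\<close>)
      then show ?thesis
        by (simp add: Henstock_Kurzweil_Integration.integral_diff
            integrable_continuous_real cP u v)
    qed
    have "T u t - T v t
        = (P u t - P v t) + 2 * (integral {0..1} (P u) - integral {0..1} (P v)) * t"
      by (simp add: T_def algebra_simps)
    also have "\<bar>\<dots>\<bar> \<le> \<bar>P u t - P v t\<bar> +
        2 * \<bar>integral {0..1} (P u) - integral {0..1} (P v)\<bar> * \<bar>t\<bar>"
      by (rule order_trans[OF abs_triangle_ineq]) (simp only: abs_mult abs_numeral order_refl)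
    also have "\<dots> \<le> L * M + 2 * (L * M) * 1"
      using uv[OF _ t] I t by (intro add_mono mult_mono) auto
    finally show ?thesis by simp
  qed
  obtain u where u: "continuous_on {0..1} u" "\<And>t. t \<in> {0..1} \<Longrightarrow> u t = T u t"
    by (rule contraction_fixed_point_Icc[of 0 1 "3 * L" T])
       (use L L0 cT contr in \<open>auto simp: dist_real_def\<close>)
  \<comment> \<open>The slope of \<open>u\<close> at \<open>0\<close>; the factor \<open>2\<close> is what makes it equal to the integral of \<open>u\<close>.\<close>
  define d where "d = 2 * integral {0..1} (P u)"
  have u_eq: "u t = rl_integral \<zeta> (\<lambda>s. h s (u s)) t + d * t + 0" if "t \<in> {0..1}" for t
    using u(2)[OF that] by (simp add: T_def P_def d_def)
  have "integral {0..1} u = integral {0..1} (\<lambda>t. P u t + d * t)"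
    using u_eq by (intro Henstock_Kurzweil_Integration.integral_cong) (simp add: P_def)
  also have "\<dots> = integral {0..1} (P u) + d * integral {0..1} (\<lambda>t. t)"
    by (subst Henstock_Kurzweil_Integration.integral_add)
       (auto intro!: integrable_continuous_real continuous_intros cP u)
  also have "\<dots> = d"
    using ident_has_integral[of 0 "1::real"] by (simp add: integral_unique d_def)
  finally have d: "rl_integral 1 u 1 = d" by (simp add: rl_integral_1)
  have "u 0 = 0" using u_eq[of 0] \<zeta> by (simp add: rl_integral_def)
  then show ?thesis
    using u(1) has_caputo_derivative_rl_integral[OF \<zeta> ch[OF u(1)] u_eq] d by metis
qed

theorem theorem4p1:
  fixes \<zeta> :: real and h :: "real \<Rightarrow> real \<Rightarrow> real"
  assumes order: "1 < \<zeta>" "\<zeta> \<le> 2"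
    and cont: "continuous_on ({0..1} \<times> UNIV) (\<lambda>(t, x). h t x)"
    and nonneg: "\<forall>t\<in>{0..1}. \<forall>x. 0 \<le> h t x"
    and nondecreasing: "\<forall>t\<in>{0..1}. \<forall>x y. x \<le> y \<longrightarrow> h t x \<le> h t y"
    and lipschitz: "\<exists>\<alpha>. 0 < \<alpha> \<and> \<alpha> < 1 \<and>
      (\<forall>\<mu>\<in>{0..1}. \<forall>u v.
         continuous_on {0..1} u \<and> continuous_on {0..1} v \<and> (\<forall>t\<in>{0..1}. u t \<le> v t) \<longrightarrow>
         \<bar>h \<mu> (u \<mu>) - h \<mu> (v \<mu>)\<bar> \<le> \<alpha> * Gamma (\<alpha> + 1) / 4 * \<bar>u \<mu> - v \<mu>\<bar>)"
  shows "\<exists>f. continuous_on {0..1} f \<and>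
           has_caputo_derivative \<zeta> f (\<lambda>t. h t (f t)) \<and>
           f 0 = 0 \<and>
           (f has_real_derivative rl_integral 1 f 1) (at 0 within {0..1})"
proof -
  obtain \<alpha> where \<alpha>: "0 < \<alpha>" "\<alpha> < 1"
    and lip: "\<And>\<mu> u v. \<mu> \<in> {0..1} \<Longrightarrow> continuous_on {0..1} u \<Longrightarrow> continuous_on {0..1} v \<Longrightarrow>
      (\<And>t. t \<in> {0..1} \<Longrightarrow> u t \<le> v t) \<Longrightarrow>
      \<bar>h \<mu> (u \<mu>) - h \<mu> (v \<mu>)\<bar> \<le> \<alpha> * Gamma (\<alpha> + 1) / 4 * \<bar>u \<mu> - v \<mu>\<bar>"
    using lipschitz by blast
  have "\<alpha> * Gamma (\<alpha> + 1) \<le> 1 * 1"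
    using \<alpha> Gamma_real_le_1[of "\<alpha> + 1"] Gamma_real_pos[of "\<alpha> + 1"]
    by (intro mult_mono) auto
  then have "3 * (\<alpha> * Gamma (\<alpha> + 1) / 4) < 1" by simp
  moreover have "\<bar>h t x - h t y\<bar> \<le> \<alpha> * Gamma (\<alpha> + 1) / 4 * \<bar>x - y\<bar>"
    if "t \<in> {0..1}" "x \<le> y" for t x y
    using lip[of t "\<lambda>_. x" "\<lambda>_. y"] that by simp
  ultimately show ?thesis
    by (intro caputo_integral_bvp_exists[OF order cont])
qed

end
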